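(* Let $\{F_\varsigma\}_{\varsigma\in\mathfrak{A}}$ be a continuous frame for $\mathcal{H}^N$ with frame operator $S_F$. If $V\in GL^{+}(\mathcal{H}^N)$ is a self-adjoint operator with $VS_F=S_FV$, then $\{F_\varsigma\}_{\varsigma\in\mathfrak{A}}$ is a $V$-controlled integral frame for $\mathcal{H}^N$.
   Context: $(\mathfrak{A},\mu)$ is a measure space with positive measure $\mu$, and $\mathcal{H}^N$ is an $N$-dimensional complex Hilbert space, with inner product linear in the first variable. Families are assumed weakly measurable: $\varsigma\mapsto\langle f,F_\varsigma\rangle$ is measurable for each $f$. A family $\{F_\varsigma\}_{\varsigma\in\mathfrak{A}}\subset\mathcal{H}^N$ is a continuous (integral) frame if there are $0<A\le B<\infty$ with $A\|f\|^2\le\int_{\mathfrak{A}}|\langle f,F_\varsigma\rangle|^2d\mu(\varsigma)\le B\|f\|^2$ for all $f$; its frame operator is $S_Ff=\int_{\mathfrak{A}}\langle f,F_\varsigma\rangle F_\varsigma\,d\mu(\varsigma)$ (weak sense). For an invertible operator $V$ on $\mathcal{H}^N$, the family is a $V$-controlled integral frame if there are $0<A\le B<\infty$ with $A\|f\|^2\le\int_{\mathfrak{A}}\langle f,F_\varsigma\rangle\langle VF_\varsigma,f\rangle\,d\mu(\varsigma)\le B\|f\|^2$ for all $f\in\mathcal{H}^N$. $GL(\mathcal{H}^N)$ is the set of bounded operators with bounded inverse, and $GL^{+}(\mathcal{H}^N)$ is the set of positive operators in $GL(\mathcal{H}^N)$. *)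

theory Defs
  imports "HOL-Analysis.Analysis"
begin

text \<open>
  Complex inner product spaces, with inner product linear in the first variable. The underlying
  real inner product is tied to the complex one by \<open>inner_eq_Re_cinner\<close>, so that the library
  norm is the one induced by \<open>cinner\<close> (see \<open>cinner_self\<close> below, which also contains positive
  definiteness).
\<close>

class complex_inner = real_inner +
  fixes scaleC :: "complex \<Rightarrow> 'a \<Rightarrow> 'a" (infixr "*\<^sub>C" 75)
    and cinner :: "'a \<Rightarrow> 'a \<Rightarrow> complex"
  assumes scaleC_add_right: "c *\<^sub>C (x + y) = c *\<^sub>C x + c *\<^sub>C y"
    and scaleC_add_left: "(c + d) *\<^sub>C x = c *\<^sub>C x + d *\<^sub>C x"
    and scaleC_scaleC: "c *\<^sub>C (d *\<^sub>C x) = (c * d) *\<^sub>C x"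
    and scaleC_one: "1 *\<^sub>C x = x"
    and scaleR_eq_scaleC: "scaleR r x = complex_of_real r *\<^sub>C x"
    and cinner_commute: "cinner x y = cnj (cinner y x)"
    and cinner_add_left: "cinner (x + y) z = cinner x z + cinner y z"
    and cinner_scaleC_left: "cinner (c *\<^sub>C x) y = c * cinner x y"
    and inner_eq_Re_cinner: "inner x y = Re (cinner x y)"

class complex_hilbert = complex_inner + complete_space

lemma cinner_self: "cinner x x = complex_of_real ((norm x)\<^sup>2)"
proof -
  have "Im (cinner x x) = 0"
    using arg_cong[OF cinner_commute[of x x], of Im] by simp
  then show ?thesis
    by (simp add: complex_eq_iff power2_norm_eq_inner inner_eq_Re_cinner)
qed

lemma vector_space_scaleC: "vector_space (scaleC :: complex \<Rightarrow> 'a \<Rightarrow> 'a::complex_inner)"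
  by unfold_locales (simp_all add: scaleC_add_right scaleC_add_left scaleC_scaleC scaleC_one)

text \<open>The instances \<open>complex ^ 'n\<close> show that the classes are inhabited in every positive finite dimension.\<close>

instantiation complex :: complex_hilbert
begin

definition scaleC_complex :: "complex \<Rightarrow> complex \<Rightarrow> complex"
  where "scaleC_complex c x = c * x"

definition cinner_complex :: "complex \<Rightarrow> complex \<Rightarrow> complex"
  where "cinner_complex x y = x * cnj y"

instance
  by standard
    (simp_all add: scaleC_complex_def cinner_complex_def algebra_simps inner_complex_def
      scaleR_conv_of_real)

end

instantiation vec :: (complex_inner, finite) complex_inner
begin

definition scaleC_vec :: "complex \<Rightarrow> 'a ^ 'b \<Rightarrow> 'a ^ 'b"
  where "scaleC_vec c x = (\<chi> i. c *\<^sub>C x $ i)"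

definition cinner_vec :: "'a ^ 'b \<Rightarrow> 'a ^ 'b \<Rightarrow> complex"
  where "cinner_vec x y = (\<Sum>i\<in>UNIV. cinner (x $ i) (y $ i))"

instance
proof
  fix x y :: "'a ^ 'b"
  show "cinner x y = cnj (cinner y x)"
    unfolding cinner_vec_def cnj_sum by (rule sum.cong) (auto intro: cinner_commute)
qed (simp_all add: scaleC_vec_def cinner_vec_def vec_eq_iff scaleC_add_right scaleC_add_left
      scaleC_scaleC scaleC_one scaleR_eq_scaleC cinner_add_left cinner_scaleC_left
      sum.distrib sum_distrib_left inner_vec_def inner_eq_Re_cinner)

end

instance vec :: (complex_hilbert, finite) complex_hilbert ..

definition bounded_operator :: "('h::complex_inner \<Rightarrow> 'h) \<Rightarrow> bool"
  where "bounded_operator T \<longleftrightarrow>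
    Vector_Spaces.linear scaleC scaleC T \<and> (\<exists>K. \<forall>f. norm (T f) \<le> K * norm f)"

definition GL :: "('h::complex_inner \<Rightarrow> 'h) set"
  where "GL = {T. bounded_operator T \<and> bij T \<and> bounded_operator (inv T)}"

definition positive_operator :: "('h::complex_inner \<Rightarrow> 'h) \<Rightarrow> bool"
  where "positive_operator T \<longleftrightarrow> (\<forall>f. cinner (T f) f \<in> \<real> \<and> 0 \<le> Re (cinner (T f) f))"

definition GL_pos :: "('h::complex_inner \<Rightarrow> 'h) set"
  where "GL_pos = {T \<in> GL. positive_operator T}"

definition self_adjoint :: "('h::complex_inner \<Rightarrow> 'h) \<Rightarrow> bool"
  where "self_adjoint T \<longleftrightarrow> (\<forall>f g. cinner (T f) g = cinner f (T g))"

definition weakly_measurable :: "'x measure \<Rightarrow> ('x \<Rightarrow> 'h::complex_inner) \<Rightarrow> bool"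
  where "weakly_measurable M F \<longleftrightarrow> (\<forall>f. (\<lambda>s. cinner f (F s)) \<in> borel_measurable M)"

definition continuous_frame :: "'x measure \<Rightarrow> ('x \<Rightarrow> 'h::complex_inner) \<Rightarrow> bool"
  where "continuous_frame M F \<longleftrightarrow> weakly_measurable M F \<and>
    (\<exists>A B :: real. 0 < A \<and> A \<le> B \<and> (\<forall>f.
      ennreal (A * (norm f)\<^sup>2) \<le> (\<integral>\<^sup>+ s. ennreal ((cmod (cinner f (F s)))\<^sup>2) \<partial>M) \<and>
      (\<integral>\<^sup>+ s. ennreal ((cmod (cinner f (F s)))\<^sup>2) \<partial>M) \<le> ennreal (B * (norm f)\<^sup>2)))"

text \<open>
  The integral of \<open>\<lambda>s. cinner f (F s) *\<^sub>C F s\<close> is taken in the weak sense: it is the vector \<open>h\<close>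
  whose inner product with each \<open>g\<close> is the integral of the inner products.
\<close>

definition frame_operator :: "'x measure \<Rightarrow> ('x \<Rightarrow> 'h::complex_inner) \<Rightarrow> 'h \<Rightarrow> 'h"
  where "frame_operator M F f =
    (THE h. \<forall>g. cinner h g = (\<integral>s. cinner (cinner f (F s) *\<^sub>C F s) g \<partial>M))"

text \<open>
  The controlled integrand is complex-valued, and the Bochner integral of a non-integrable function
  is 0 by convention; the two-sided estimate therefore presupposes that the integral exists and is
  real, which is spelled out.
\<close>

definition controlled_frame ::
    "('h \<Rightarrow> 'h) \<Rightarrow> 'x measure \<Rightarrow> ('x \<Rightarrow> 'h::complex_inner) \<Rightarrow> bool"
  where "controlled_frame V M F \<longleftrightarrow> V \<in> GL \<and> weakly_measurable M F \<and>
    (\<exists>A B :: real. 0 < A \<and> A \<le> B \<and> (\<forall>f.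
      integrable M (\<lambda>s. cinner f (F s) * cinner (V (F s)) f) \<and>
      (\<integral>s. cinner f (F s) * cinner (V (F s)) f \<partial>M) \<in> \<real> \<and>
      A * (norm f)\<^sup>2 \<le> Re (\<integral>s. cinner f (F s) * cinner (V (F s)) f \<partial>M) \<and>
      Re (\<integral>s. cinner f (F s) * cinner (V (F s)) f \<partial>M) \<le> B * (norm f)\<^sup>2))"

end

theory Submission
  imports Defs
begin

text \<open>
  Since \<open>V\<close> is self-adjoint, the controlled integral at \<open>f\<close> is
  \<open>\<integral> \<langle>f, F\<^sub>s\<rangle> \<langle>F\<^sub>s, V f\<rangle> = \<langle>S f, V f\<rangle> = \<langle>V S f, f\<rangle>\<close>, so everything comes down to bounding the
  quadratic form of a product of two commuting positive operators. Square roots and the spectral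
  theorem can be avoided by regarding \<open>\<langle>V x, y\<rangle>\<close> as a second, positive semidefinite, inner product.
  An operator \<open>T\<close> that is self-adjoint and commutes with \<open>V\<close> is symmetric for the second inner product
  as well, and by an argument of Krein its norm for the second product is at most its original norm
  (\<open>commuting_quadratic_form_bound\<close>): the numbers \<open>\<langle>V T\<^sup>k x, T\<^sup>k x\<rangle>\<close> form a log-convex sequence, so
  a first ratio that is too large would force faster geometric growth than the norm of \<open>T\<close> allows.

  If the frame has bounds \<open>A\<close> and \<open>B\<close>, then \<open>T = B - S\<close> satisfies \<open>0 \<le> T \<le> B - A\<close>, hence has norm
  at most \<open>B - A\<close>, and the comparison gives
  \<open>\<bar>B \<langle>V f, f\<rangle> - \<langle>V S f, f\<rangle>\<bar> \<le> (B - A) \<langle>V f, f\<rangle>\<close>, that is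
  \<open>A \<langle>V f, f\<rangle> \<le> \<langle>V S f, f\<rangle> \<le> (2 B - A) \<langle>V f, f\<rangle>\<close>. A positive operator with bounded inverse is
  coercive (\<open>positive_bounded_below_imp_coercive\<close>), so \<open>\<langle>V f, f\<rangle>\<close> is comparable with the squared norm.

  The frame operator is a definite description; that a vector of the required kind exists is the
  Riesz representation of the bounded sesquilinear form given by the integral, which finite dimension
  makes explicit through an orthogonal basis over the reals (\<open>riesz_finite_span\<close>).
\<close>

section \<open>Positive symmetric operators on real inner product spaces\<close>

lemma Cauchy_Schwarz_positive_operator:
  fixes V :: "'a::real_inner \<Rightarrow> 'a"
  assumes lin: "linear V"
    and sym: "\<And>x y. inner (V x) y = inner x (V y)"
    and pos: "\<And>x. 0 \<le> inner (V x) x"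
  shows "(inner (V x) y)\<^sup>2 \<le> inner (V x) x * inner (V y) y"
proof -
  define a b c where "a = inner (V x) x" and "b = inner (V x) y" and "c = inner (V y) y"
  have yx: "inner (V y) x = b"
    unfolding b_def using sym[of y x] by (simp add: inner_commute)
  have expand: "0 \<le> r\<^sup>2 * a + 2 * r * t * b + t\<^sup>2 * c" for r t
  proof -
    have "inner (V (r *\<^sub>R x + t *\<^sub>R y)) (r *\<^sub>R x + t *\<^sub>R y) = r\<^sup>2 * a + 2 * r * t * b + t\<^sup>2 * c"
      by (simp add: linear_add[OF lin] linear_scale[OF lin] inner_add_left inner_add_right yx
          flip: a_def b_def c_def) (simp add: power2_eq_square algebra_simps)
    then show ?thesis
      using pos[of "r *\<^sub>R x + t *\<^sub>R y"] by simp
  qed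
  have c0: "0 \<le> c"
    unfolding c_def by (rule pos)
  have "b\<^sup>2 \<le> a * c"
  proof (cases "c = 0")
    case True
    \<comment> \<open>The form is then affine in \<open>t\<close> at \<open>x + t y\<close>, and takes the value \<open>-1\<close> here unless \<open>b = 0\<close>.\<close>
    have "b = 0"
      using expand[of 1 "- (a + 1) / (2 * b)"] True by (cases "b = 0") (simp_all add: field_simps)
    then show ?thesis
      using True by simp
  next
    case False
    \<comment> \<open>The vector \<open>c x - b y\<close> is \<open>c\<close> times the part of \<open>x\<close> orthogonal to \<open>y\<close> for the form.\<close>
    have "0 \<le> c * (a * c - b\<^sup>2)"
      using expand[of c "- b"] by (simp add: power2_eq_square algebra_simps)
    then show ?thesis
      using False c0 by (simp add: zero_le_mult_iff)
  qed
  then show ?thesis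
    by (simp add: a_def b_def c_def)
qed

text \<open>
  Insert \<open>y = V x\<close> in the Cauchy--Schwarz inequality for the form of \<open>V\<close> and cancel one factor
  \<open>(norm (V x))\<^sup>2\<close>.
\<close>

lemma positive_operator_norm_le_form:
  fixes V :: "'a::real_inner \<Rightarrow> 'a"
  assumes lin: "linear V"
    and sym: "\<And>x y. inner (V x) y = inner x (V y)"
    and pos: "\<And>x. 0 \<le> inner (V x) x"
    and upper: "\<And>x. inner (V x) x \<le> K * (norm x)\<^sup>2"
  shows "(norm (V x))\<^sup>2 \<le> K * inner (V x) x"
proof (cases "V x = 0")
  case False
  define n where "n = (norm (V x))\<^sup>2"
  have n: "0 < n"
    using False by (simp add: n_def)
  have "n\<^sup>2 \<le> inner (V x) x * inner (V (V x)) (V x)"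
    using Cauchy_Schwarz_positive_operator[OF lin sym pos, of x "V x"]
    by (simp add: n_def power2_norm_eq_inner)
  also have "\<dots> \<le> inner (V x) x * (K * n)"
    unfolding n_def by (intro mult_left_mono upper pos)
  finally have "n * n \<le> (K * inner (V x) x) * n"
    by (simp add: power2_eq_square algebra_simps)
  then show ?thesis
    using n unfolding n_def[symmetric] by (rule mult_right_le_imp_le)
qed simp

lemma positive_operator_norm_bound:
  fixes T :: "'a::real_inner \<Rightarrow> 'a"
  assumes "linear T"
    and "\<And>x y. inner (T x) y = inner x (T y)"
    and "\<And>x. 0 \<le> inner (T x) x"
    and upper: "\<And>x. inner (T x) x \<le> K * (norm x)\<^sup>2"
    and K: "0 \<le> K"
  shows "norm (T x) \<le> K * norm x"
proof -
  have "(norm (T x))\<^sup>2 \<le> K * inner (T x) x"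
    by (rule positive_operator_norm_le_form) fact+
  also have "\<dots> \<le> K * (K * (norm x)\<^sup>2)"
    by (intro mult_left_mono upper K)
  also have "\<dots> = (K * norm x)\<^sup>2"
    by (simp add: power2_eq_square algebra_simps)
  finally show ?thesis
    by (rule power2_le_imp_le) (simp add: K)
qed

lemma positive_bounded_below_imp_coercive:
  fixes V :: "'a::real_inner \<Rightarrow> 'a"
  assumes "linear V"
    and "\<And>x y. inner (V x) y = inner x (V y)"
    and "\<And>x. 0 \<le> inner (V x) x"
    and "\<And>x. inner (V x) x \<le> K * (norm x)\<^sup>2"
    and below: "\<And>x. norm x \<le> L * norm (V x)"
  shows "(norm x)\<^sup>2 \<le> L\<^sup>2 * K * inner (V x) x"
proof -
  have "(norm x)\<^sup>2 \<le> (L * norm (V x))\<^sup>2"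
    by (rule power_mono[OF below norm_ge_zero])
  also have "\<dots> = L\<^sup>2 * (norm (V x))\<^sup>2"
    by (rule power_mult_distrib)
  also have "\<dots> \<le> L\<^sup>2 * (K * inner (V x) x)"
    by (intro mult_left_mono positive_operator_norm_le_form) (fact+, simp)
  finally show ?thesis
    by (simp add: mult.assoc)
qed

text \<open>
  Log-convexity makes the ratios of consecutive terms nondecreasing, so a first ratio above \<open>r\<close>
  would be a lower bound for all of them, which contradicts growth of order \<open>r\<^sup>k\<close>.
\<close>

lemma log_convex_first_ratio_le:
  fixes a :: "nat \<Rightarrow> real"
  assumes nonneg: "\<And>k. 0 \<le> a k"
    and conv: "\<And>k. (a (Suc k))\<^sup>2 \<le> a k * a (Suc (Suc k))"
    and growth: "\<And>k. a k \<le> C * r ^ k"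
    and r: "0 \<le> r"
  shows "a 1 \<le> r * a 0"
proof (rule ccontr)
  assume contra: "\<not> a 1 \<le> r * a 0"
  have a1: "0 < a 1"
    using contra nonneg[of 0] r by (smt (verit) mult_nonneg_nonneg)
  have a0: "0 < a 0"
    using conv[of 0] a1 nonneg[of 0] by (cases "a 0 = 0") auto
  define q where "q = a 1 / a 0"
  have q: "r < q" "0 < q"
    using contra a0 a1 by (simp_all add: q_def field_simps)
  have step: "0 < a k \<and> q * a k \<le> a (Suc k)" for k
  proof (induction k)
    case 0
    then show ?case
      using a0 by (simp add: q_def)
  next
    case (Suc k)
    then have k: "0 < a k" and le: "q * a k \<le> a (Suc k)"
      by auto
    have k1: "0 < a (Suc k)"
      using k le q by (smt (verit) mult_pos_pos)
    have "a k * (q * a (Suc k)) = (q * a k) * a (Suc k)"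
      by simp
    also have "\<dots> \<le> a (Suc k) * a (Suc k)"
      using le k1 by (intro mult_right_mono) auto
    also have "\<dots> \<le> a k * a (Suc (Suc k))"
      using conv[of k] by (simp add: power2_eq_square)
    finally show ?case
      using k k1 by simp
  qed
  have geo: "q ^ k * a 0 \<le> a k" for k
  proof (induction k)
    case (Suc k)
    have "q ^ Suc k * a 0 = q * (q ^ k * a 0)"
      by simp
    also have "\<dots> \<le> q * a k"
      using Suc q by (intro mult_left_mono) auto
    also have "\<dots> \<le> a (Suc k)"
      using step by blast
    finally show ?case .
  qed simp
  have "(\<lambda>k. C * (r / q) ^ k) \<longlonglongrightarrow> C * 0"
    using q r by (intro tendsto_mult tendsto_const LIMSEQ_power_zero) auto
  moreover have "a 0 \<le> C * (r / q) ^ k" for k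
    using order_trans[OF geo growth, of k] q by (simp add: power_divide field_simps)
  ultimately have "a 0 \<le> C * 0"
    by (intro LIMSEQ_le_const) auto
  then show False
    using a0 by simp
qed

text \<open>
  Apply the ratio bound to \<open>a k = \<langle>V T\<^sup>k x, T\<^sup>k x\<rangle>\<close>. It is log-convex by the Cauchy--Schwarz
  inequality for the form of \<open>V\<close>, because commutation and symmetry let one factor \<open>T\<close> pass from one
  argument to the other. One more use of Cauchy--Schwarz passes from \<open>\<langle>V T x, T x\<rangle>\<close> to
  \<open>\<langle>V T x, x\<rangle>\<close>.
\<close>

lemma commuting_quadratic_form_bound:
  fixes V T :: "'a::real_inner \<Rightarrow> 'a"
  assumes lin: "linear V"
    and sym: "\<And>x y. inner (V x) y = inner x (V y)"
    and pos: "\<And>x. 0 \<le> inner (V x) x"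
    and upper: "\<And>x. inner (V x) x \<le> K * (norm x)\<^sup>2"
    and K: "0 \<le> K"
    and symT: "\<And>x y. inner (T x) y = inner x (T y)"
    and normT: "\<And>x. norm (T x) \<le> r * norm x"
    and r: "0 \<le> r"
    and comm: "\<And>x. V (T x) = T (V x)"
  shows "\<bar>inner (V (T x)) x\<bar> \<le> r * inner (V x) x"
proof -
  note CS = Cauchy_Schwarz_positive_operator[OF lin sym pos]
  define w where "w k = (T ^^ k) x" for k
  have w: "w 0 = x" "\<And>k. w (Suc k) = T (w k)"
    by (simp_all add: w_def)
  define a where "a k = inner (V (w k)) (w k)" for k
  have norm_w: "norm (w k) \<le> r ^ k * norm x" for k
  proof (induction k)
    case (Suc k)
    have "norm (w (Suc k)) \<le> r * norm (w k)"
      using normT by (simp add: w)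
    also have "\<dots> \<le> r * (r ^ k * norm x)"
      using Suc r by (rule mult_left_mono)
    finally show ?case
      by (simp add: mult.assoc)
  qed (simp add: w)
  have "a 1 \<le> r\<^sup>2 * a 0"
  proof (rule log_convex_first_ratio_le[where C = "K * (norm x)\<^sup>2"])
    show "0 \<le> a k" for k
      unfolding a_def by (rule pos)
    show "(a (Suc k))\<^sup>2 \<le> a k * a (Suc (Suc k))" for k
    proof -
      have "a (Suc k) = inner (V (w k)) (w (Suc (Suc k)))"
        by (simp add: a_def w comm symT)
      then show ?thesis
        using CS[of "w k" "w (Suc (Suc k))"] by (simp add: a_def)
    qed
    show "a k \<le> K * (norm x)\<^sup>2 * (r\<^sup>2) ^ k" for k
    proof -
      have "a k \<le> K * (norm (w k))\<^sup>2"
        unfolding a_def by (rule upper)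
      also have "\<dots> \<le> K * (r ^ k * norm x)\<^sup>2"
        by (intro mult_left_mono power_mono norm_w K) simp
      also have "\<dots> = K * (norm x)\<^sup>2 * (r\<^sup>2) ^ k"
        by (simp add: power_mult_distrib power_mult[symmetric] mult.commute mult.left_commute)
      finally show ?thesis .
    qed
  qed simp
  then have "a 1 * a 0 \<le> (r * a 0)\<^sup>2"
    using mult_right_mono[of "a 1" "r\<^sup>2 * a 0" "a 0"] pos[of x]
    by (simp add: a_def w power2_eq_square algebra_simps)
  moreover have "(inner (V (T x)) x)\<^sup>2 \<le> a 1 * a 0"
    using CS[of "T x" x] by (simp add: a_def w)
  ultimately have "\<bar>inner (V (T x)) x\<bar>\<^sup>2 \<le> (r * a 0)\<^sup>2"
    by simp
  then have "\<bar>inner (V (T x)) x\<bar> \<le> r * a 0"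
    by (rule power2_le_imp_le) (simp add: a_def w pos r)
  then show ?thesis
    by (simp add: a_def w)
qed

text \<open>
  The substitution \<open>T = B - S\<close> makes the two bounds on \<open>S\<close> into a single bound on the norm of \<open>T\<close>.
\<close>

lemma commuting_product_form_bounds:
  fixes V S :: "'a::real_inner \<Rightarrow> 'a"
  assumes lin: "linear V"
    and sym: "\<And>x y. inner (V x) y = inner x (V y)"
    and pos: "\<And>x. 0 \<le> inner (V x) x"
    and upper: "\<And>x. inner (V x) x \<le> K * (norm x)\<^sup>2"
    and K: "0 \<le> K"
    and linS: "linear S"
    and symS: "\<And>x y. inner (S x) y = inner x (S y)"
    and lowS: "\<And>x. A * (norm x)\<^sup>2 \<le> inner (S x) x"
    and uppS: "\<And>x. inner (S x) x \<le> B * (norm x)\<^sup>2"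
    and AB: "A \<le> B"
    and comm: "\<And>x. V (S x) = S (V x)"
  shows "A * inner (V x) x \<le> inner (V (S x)) x"
    and "inner (V (S x)) x \<le> (2 * B - A) * inner (V x) x"
proof -
  define T where "T x = B *\<^sub>R x - S x" for x
  have linT: "linear T"
    unfolding T_def by (intro linear_compose_sub linS linear_scale_self)
  have symT: "inner (T x) y = inner x (T y)" for x y
    by (simp add: T_def inner_diff_left inner_diff_right symS)
  have form: "inner (T x) x = B * (norm x)\<^sup>2 - inner (S x) x" for x
    by (simp add: T_def inner_diff_left power2_norm_eq_inner)
  have normT: "norm (T x) \<le> (B - A) * norm x" for x
  proof (rule positive_operator_norm_bound[OF linT symT])
    show "0 \<le> inner (T x) x" for x
      using uppS[of x] by (simp add: form)
    show "inner (T x) x \<le> (B - A) * (norm x)\<^sup>2" for x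
      using lowS[of x] by (simp add: form algebra_simps)
  qed (use AB in simp)
  have commT: "V (T x) = T (V x)" for x
    by (simp add: T_def linear_diff[OF lin] linear_scale[OF lin] comm)
  have "\<bar>inner (V (T x)) x\<bar> \<le> (B - A) * inner (V x) x"
    using AB by (intro commuting_quadratic_form_bound[OF lin sym pos upper K symT normT _ commT]) simp
  moreover have "inner (V (T x)) x = B * inner (V x) x - inner (V (S x)) x"
    by (simp add: T_def linear_diff[OF lin] linear_scale[OF lin] inner_diff_left)
  ultimately show "A * inner (V x) x \<le> inner (V (S x)) x"
    and "inner (V (S x)) x \<le> (2 * B - A) * inner (V x) x"
    by (simp_all add: abs_le_iff algebra_simps)
qed

section \<open>Complex inner products and Riesz representation\<close>

lemma cinner_add_right: "cinner x (y + z) = cinner x y + cinner x z"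
  by (metis cinner_add_left cinner_commute complex_cnj_add)

lemma cinner_scaleC_right: "cinner x (c *\<^sub>C y) = cnj c * cinner x y"
  by (metis cinner_scaleC_left cinner_commute complex_cnj_mult)

lemma cmod_cinner_commute: "cmod (cinner x y) = cmod (cinner y x)"
  by (metis cinner_commute complex_mod_cnj)

lemma cinner_eqI:
  assumes "\<And>g. cinner h g = cinner k g"
  shows "h = k"
proof -
  have "inner h (h - k) = inner k (h - k)"
    by (simp add: inner_eq_Re_cinner assms)
  then have "inner (h - k) (h - k) = 0"
    by (simp add: inner_diff_left)
  then show ?thesis
    by simp
qed

lemma complex_linear_imp_linear:
  fixes T :: "'h::complex_inner \<Rightarrow> 'h"
  assumes "Vector_Spaces.linear scaleC scaleC T"
  shows "linear T"
proof -
  interpret T: Vector_Spaces.linear scaleC scaleC T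
    by fact
  show ?thesis
    by (rule linearI) (simp_all add: T.add T.scale scaleR_eq_scaleC)
qed

text \<open>The representing vector is the Fourier sum of \<open>\<phi>\<close> over an orthogonal spanning set.\<close>

lemma riesz_finite_span:
  fixes \<phi> :: "'a::real_inner \<Rightarrow> real" and X :: "'a set"
  assumes lin: "linear \<phi>" and fin: "finite X" and span: "span X = UNIV"
  obtains h where "\<And>g. inner h g = \<phi> g"
proof -
  obtain C where C: "finite C" "span C = span X" "pairwise orthogonal C"
    using basis_orthogonal[OF fin] by blast
  define h where "h = (\<Sum>c\<in>C. (\<phi> c / (inner c c)) *\<^sub>R c)"
  have on_C: "inner h c = \<phi> c" if "c \<in> C" for c
  proof -
    have "inner h c = (\<Sum>d\<in>C. \<phi> d / inner d d * inner d c)"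
      by (simp add: h_def inner_sum_left)
    also have "\<dots> = (\<Sum>d\<in>C. if d = c then \<phi> c else 0)"
    proof (rule sum.cong)
      \<comment> \<open>The set \<open>C\<close> may contain 0; both sides then vanish at \<open>d = c = 0\<close> because \<open>\<phi> 0 = 0\<close>.\<close>
      fix d assume "d \<in> C"
      then show "\<phi> d / inner d d * inner d c = (if d = c then \<phi> c else 0)"
        using C(3) that linear_0[OF lin] by (auto simp: pairwise_def orthogonal_def)
    qed simp
    also have "\<dots> = \<phi> c"
      using C(1) that by simp
    finally show ?thesis .
  qed
  have linh: "linear (inner h)"
    by (simp add: bounded_linear.linear bounded_linear_inner_right)
  have "inner h g = \<phi> g" for g
    by (rule linear_eq_on_span[OF linh lin, of C]) (use on_C C(2) span in auto)
  then show ?thesis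
    by (rule that)
qed

lemma finite_real_spanning_set:
  assumes "finite_dimensional_vector_space (scaleC :: complex \<Rightarrow> 'h \<Rightarrow> 'h) basis"
  obtains X :: "('h::complex_inner) set" where "finite X" "span X = UNIV"
proof -
  interpret C: finite_dimensional_vector_space "scaleC :: complex \<Rightarrow> 'h \<Rightarrow> 'h" basis
    by fact
  define X where "X = basis \<union> scaleC \<i> ` basis"
  have "x \<in> span X" if "x \<in> C.span basis" for x
    using that
  proof (induction rule: C.span_induct_alt)
    case base
    then show ?case
      by (rule span_zero)
  next
    case (step c b y)
    have "c *\<^sub>C b = (complex_of_real (Re c) + complex_of_real (Im c) * \<i>) *\<^sub>C b"
      by (subst complex_eq[of c]) (simp add: mult.commute)
    also have "\<dots> = Re c *\<^sub>R b + Im c *\<^sub>R (\<i> *\<^sub>C b)"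
      by (simp add: scaleC_add_left scaleR_eq_scaleC scaleC_scaleC)
    finally have eq: "c *\<^sub>C b = Re c *\<^sub>R b + Im c *\<^sub>R (\<i> *\<^sub>C b)" .
    have "b \<in> X" "\<i> *\<^sub>C b \<in> X"
      using step by (auto simp: X_def)
    then show ?case
      unfolding eq using step by (intro span_add span_scale) (auto intro: span_base)
  qed
  then have "span X = UNIV"
    using C.span_Basis by auto
  then show ?thesis
    using C.finite_Basis by (intro that[of X]) (auto simp: X_def)
qed

text \<open>
  A conjugate-linear functional is determined by its real part, so the real representation suffices:
  the imaginary part is the real part at \<open>\<i> g\<close>.
\<close>

lemma riesz_conjugate_linear:
  fixes \<phi> :: "'h::complex_inner \<Rightarrow> complex"
  assumes fd: "finite_dimensional_vector_space (scaleC :: complex \<Rightarrow> 'h \<Rightarrow> 'h) basis"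
    and add: "\<And>g h. \<phi> (g + h) = \<phi> g + \<phi> h"
    and scale: "\<And>c g. \<phi> (c *\<^sub>C g) = cnj c * \<phi> g"
  obtains h where "\<And>g. cinner h g = \<phi> g"
proof -
  obtain X :: "'h set" where X: "finite X" "span X = UNIV"
    using finite_real_spanning_set[OF fd] .
  have "linear (\<lambda>g. Re (\<phi> g))"
    by (rule linearI) (simp_all add: add scale scaleR_eq_scaleC)
  then obtain h where h: "\<And>g. inner h g = Re (\<phi> g)"
    using X riesz_finite_span by metis
  have "cinner h g = \<phi> g" for g
  proof (rule complex_eqI)
    show "Re (cinner h g) = Re (\<phi> g)"
      using h by (simp add: inner_eq_Re_cinner)
    show "Im (cinner h g) = Im (\<phi> g)"
      using h[of "\<i> *\<^sub>C g"] by (simp add: inner_eq_Re_cinner cinner_scaleC_right scale)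
  qed
  then show ?thesis
    by (rule that)
qed

section \<open>The frame operator\<close>

lemma continuous_frame_measurable:
  assumes "continuous_frame M F"
  shows "(\<lambda>s. cinner f (F s)) \<in> borel_measurable M"
    and "(\<lambda>s. cinner (F s) f) \<in> borel_measurable M"
proof -
  show left: "(\<lambda>s. cinner f (F s)) \<in> borel_measurable M"
    using assms by (auto simp: continuous_frame_def weakly_measurable_def)
  have "(\<lambda>s. cnj (cinner f (F s))) \<in> borel_measurable M"
    using left by (rule measurable_compose)
      (intro borel_measurable_continuous_onI continuous_intros)
  then show "(\<lambda>s. cinner (F s) f) \<in> borel_measurable M"
    by (simp flip: cinner_commute)
qed

lemma continuous_frame_square_integrable:
  assumes "continuous_frame M F"
  shows "integrable M (\<lambda>s. (cmod (cinner f (F s)))\<^sup>2)"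
proof (rule integrableI_nonneg)
  show "(\<lambda>s. (cmod (cinner f (F s)))\<^sup>2) \<in> borel_measurable M"
    using continuous_frame_measurable(1)[OF assms, of f] by measurable
  show "(\<integral>\<^sup>+ s. ennreal ((cmod (cinner f (F s)))\<^sup>2) \<partial>M) < \<infinity>"
    using assms unfolding continuous_frame_def
    by (metis ennreal_less_top infinity_ennreal_def order_le_less_trans)
qed simp

text \<open>The integrand is dominated by \<open>\<bar>u\<bar> \<bar>v\<bar> \<le> \<bar>u\<bar>\<^sup>2 + \<bar>v\<bar>\<^sup>2\<close>.\<close>

lemma continuous_frame_product_integrable:
  assumes "continuous_frame M F"
  shows "integrable M (\<lambda>s. cinner f (F s) * cinner (F s) g)"
proof (rule Bochner_Integration.integrable_bound)
  show "integrable M (\<lambda>s. (cmod (cinner f (F s)))\<^sup>2 + (cmod (cinner g (F s)))\<^sup>2)"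
    by (intro Bochner_Integration.integrable_add continuous_frame_square_integrable assms)
  show "(\<lambda>s. cinner f (F s) * cinner (F s) g) \<in> borel_measurable M"
    by (intro borel_measurable_times continuous_frame_measurable assms)
  have "u * v \<le> u\<^sup>2 + v\<^sup>2" if "0 \<le> u" "0 \<le> v" for u v :: real
    using that sum_squares_bound[of u v] mult_nonneg_nonneg[of u v] by linarith
  then show "AE s in M. norm (cinner f (F s) * cinner (F s) g)
      \<le> norm ((cmod (cinner f (F s)))\<^sup>2 + (cmod (cinner g (F s)))\<^sup>2)"
    by (simp add: norm_mult cmod_cinner_commute[of _ g])
qed

lemma cinner_frame_operator:
  fixes F :: "'x \<Rightarrow> 'h::complex_inner"
  assumes fd: "finite_dimensional_vector_space (scaleC :: complex \<Rightarrow> 'h \<Rightarrow> 'h) basis"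
    and frame: "continuous_frame M F"
  shows "cinner (frame_operator M F f) g = (\<integral>s. cinner f (F s) * cinner (F s) g \<partial>M)"
proof -
  define \<phi> where "\<phi> g = (\<integral>s. cinner f (F s) * cinner (F s) g \<partial>M)" for g
  note integ = continuous_frame_product_integrable[OF frame]
  have "\<phi> (g + h) = \<phi> g + \<phi> h" for g h
    unfolding \<phi>_def
    by (simp add: cinner_add_right distrib_left Bochner_Integration.integral_add[OF integ integ])
  moreover have "\<phi> (c *\<^sub>C g) = cnj c * \<phi> g" for c g
    unfolding \<phi>_def by (simp add: cinner_scaleC_right mult.left_commute)
  ultimately obtain h where h: "\<And>g. cinner h g = \<phi> g"
    using riesz_conjugate_linear[OF fd] by metis
  have "frame_operator M F f = h"
    unfolding frame_operator_def
  proof (rule the_equality)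
    show "\<forall>g. cinner h g = (\<integral>s. cinner (cinner f (F s) *\<^sub>C F s) g \<partial>M)"
      by (simp add: h \<phi>_def cinner_scaleC_left)
    show "k = h" if "\<forall>g. cinner k g = (\<integral>s. cinner (cinner f (F s) *\<^sub>C F s) g \<partial>M)" for k
      using that by - (rule cinner_eqI, simp add: h \<phi>_def cinner_scaleC_left)
  qed
  then show ?thesis
    by (simp add: h \<phi>_def)
qed

lemma self_adjoint_frame_operator:
  fixes F :: "'x \<Rightarrow> 'h::complex_inner"
  assumes fd: "finite_dimensional_vector_space (scaleC :: complex \<Rightarrow> 'h \<Rightarrow> 'h) basis"
    and frame: "continuous_frame M F"
  shows "self_adjoint (frame_operator M F)"
  unfolding self_adjoint_def
proof (intro allI)
  fix f g
  let ?S = "frame_operator M F"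
  have "cinner f (?S g) = cnj (cinner (?S g) f)"
    by (rule cinner_commute)
  also have "\<dots> = (\<integral>s. cnj (cinner g (F s) * cinner (F s) f) \<partial>M)"
    by (simp only: cinner_frame_operator[OF fd frame] Bochner_Integration.integral_cnj)
  also have "\<dots> = (\<integral>s. cinner f (F s) * cinner (F s) g \<partial>M)"
    by (simp add: mult.commute flip: cinner_commute)
  finally show "cinner (?S f) g = cinner f (?S g)"
    by (simp add: cinner_frame_operator[OF fd frame])
qed

lemma linear_frame_operator:
  fixes F :: "'x \<Rightarrow> 'h::complex_inner"
  assumes fd: "finite_dimensional_vector_space (scaleC :: complex \<Rightarrow> 'h \<Rightarrow> 'h) basis"
    and frame: "continuous_frame M F"
  shows "linear (frame_operator M F)"
proof -
  have adj: "cinner (frame_operator M F f) g = cinner f (frame_operator M F g)" for f g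
    using self_adjoint_frame_operator[OF fd frame] by (simp add: self_adjoint_def)
  show ?thesis
    by (rule linearI; rule cinner_eqI)
      (simp_all add: adj cinner_add_left cinner_scaleC_left scaleR_eq_scaleC)
qed

lemma frame_operator_form_bounds:
  fixes F :: "'x \<Rightarrow> 'h::complex_inner"
  assumes fd: "finite_dimensional_vector_space (scaleC :: complex \<Rightarrow> 'h \<Rightarrow> 'h) basis"
    and frame: "continuous_frame M F"
  obtains A B where "0 < A" "A \<le> B"
    "\<And>f. A * (norm f)\<^sup>2 \<le> inner (frame_operator M F f) f"
    "\<And>f. inner (frame_operator M F f) f \<le> B * (norm f)\<^sup>2"
proof -
  obtain A B where AB: "0 < A" "A \<le> B"
    and low: "\<And>f. ennreal (A * (norm f)\<^sup>2) \<le> (\<integral>\<^sup>+ s. ennreal ((cmod (cinner f (F s)))\<^sup>2) \<partial>M)"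
    and upp: "\<And>f. (\<integral>\<^sup>+ s. ennreal ((cmod (cinner f (F s)))\<^sup>2) \<partial>M) \<le> ennreal (B * (norm f)\<^sup>2)"
    using frame unfolding continuous_frame_def by blast
  have form: "inner (frame_operator M F f) f = (\<integral>s. (cmod (cinner f (F s)))\<^sup>2 \<partial>M)" for f
  proof -
    have "cinner f (F s) * cinner (F s) f = complex_of_real ((cmod (cinner f (F s)))\<^sup>2)" for s
      by (metis cinner_commute complex_norm_square)
    then have "cinner (frame_operator M F f) f
        = complex_of_real (\<integral>s. (cmod (cinner f (F s)))\<^sup>2 \<partial>M)"
      by (simp only: cinner_frame_operator[OF fd frame] integral_complex_of_real)
    then show ?thesis
      by (simp add: inner_eq_Re_cinner)
  qed
  have nn: "(\<integral>\<^sup>+ s. ennreal ((cmod (cinner f (F s)))\<^sup>2) \<partial>M)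
      = ennreal (inner (frame_operator M F f) f)" for f
    unfolding form
    by (rule nn_integral_eq_integral[OF continuous_frame_square_integrable[OF frame]]) simp
  have nonneg: "0 \<le> inner (frame_operator M F f) f" for f
    unfolding form by (rule integral_nonneg_AE) simp
  show ?thesis
  proof (rule that[OF AB])
    show "A * (norm f)\<^sup>2 \<le> inner (frame_operator M F f) f" for f
      using low[of f] nonneg[of f] by (simp add: nn ennreal_le_iff)
    show "inner (frame_operator M F f) f \<le> B * (norm f)\<^sup>2" for f
      using upp[of f] AB by (simp add: nn ennreal_le_iff)
  qed
qed

section \<open>Controlled frames\<close>

lemma GL_norm_bounds:
  assumes "V \<in> GL"
  obtains K L where "0 < K" "0 < L" "\<And>x. norm (V x) \<le> K * norm x" "\<And>x. norm x \<le> L * norm (V x)"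
proof -
  obtain K where K: "\<And>x. norm (V x) \<le> K * norm x"
    using assms by (auto simp: GL_def bounded_operator_def)
  obtain L where L: "\<And>x. norm (inv V x) \<le> L * norm x"
    using assms by (auto simp: GL_def bounded_operator_def)
  have inv: "inv V (V x) = x" for x
    using assms by (simp add: GL_def bij_is_inj)
  \<comment> \<open>On the zero space the given bounds may be nonpositive, hence the maximum with 1.\<close>
  show ?thesis
  proof (rule that[of "max 1 K" "max 1 L"])
    show "norm (V x) \<le> max 1 K * norm x" for x
      by (rule order_trans[OF K]) (intro mult_right_mono; simp)
    show "norm x \<le> max 1 L * norm (V x)" for x
      using L[of "V x"] unfolding inv
      by (rule order_trans) (intro mult_right_mono; simp)
  qed simp_all
qed

theorem theorem2p5:
  fixes M :: "'x measure"
    and F :: "'x \<Rightarrow> 'h::complex_hilbert"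
    and V :: "'h \<Rightarrow> 'h"
    and basis :: "'h set"
    and N :: nat
  assumes "finite_dimensional_vector_space (scaleC :: complex \<Rightarrow> 'h \<Rightarrow> 'h) basis"
    and "card basis = N"
    and "continuous_frame M F"
    and "V \<in> GL_pos"
    and "self_adjoint V"
    and "V \<circ> frame_operator M F = frame_operator M F \<circ> V"
  shows "controlled_frame V M F"
proof -
  note fd = assms(1) and frame = assms(3)
  define S where "S = frame_operator M F"
  have GL: "V \<in> GL" and posV: "positive_operator V"
    using assms(4) by (auto simp: GL_pos_def)
  have adjV: "cinner (V x) y = cinner x (V y)" for x y
    using assms(5) by (simp add: self_adjoint_def)
  have adjS: "cinner (S x) y = cinner x (S y)" for x y
    using self_adjoint_frame_operator[OF fd frame] by (simp add: self_adjoint_def S_def)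
  have comm: "V (S x) = S (V x)" for x
    using fun_cong[OF assms(6), of x] by (simp add: S_def)
  have linV: "linear V"
    using GL by (auto simp: GL_def bounded_operator_def intro: complex_linear_imp_linear)
  have symV: "inner (V x) y = inner x (V y)" for x y
    by (simp add: inner_eq_Re_cinner adjV)
  have pos: "0 \<le> inner (V x) x" for x
    using posV by (simp add: positive_operator_def inner_eq_Re_cinner)
  obtain K L where K: "0 < K" and L: "0 < L"
    and normV: "\<And>x. norm (V x) \<le> K * norm x" and below: "\<And>x. norm x \<le> L * norm (V x)"
    using GL_norm_bounds[OF GL] by blast
  have upper: "inner (V x) x \<le> K * (norm x)\<^sup>2" for x
  proof -
    have "inner (V x) x \<le> norm (V x) * norm x"
      by (rule norm_cauchy_schwarz)
    also have "\<dots> \<le> (K * norm x) * norm x"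
      by (intro mult_right_mono normV) simp
    finally show ?thesis
      by (simp add: power2_eq_square algebra_simps)
  qed
  have coercive: "(norm x)\<^sup>2 \<le> L\<^sup>2 * K * inner (V x) x" for x
    by (rule positive_bounded_below_imp_coercive[OF linV symV pos upper below])
  obtain A B where A: "0 < A" and AB: "A \<le> B"
    and lowS: "\<And>f. A * (norm f)\<^sup>2 \<le> inner (S f) f"
    and uppS: "\<And>f. inner (S f) f \<le> B * (norm f)\<^sup>2"
    unfolding S_def using frame_operator_form_bounds[OF fd frame] by blast
  have symS: "inner (S x) y = inner x (S y)" for x y
    by (simp add: inner_eq_Re_cinner adjS)
  have linS: "linear S"
    unfolding S_def by (rule linear_frame_operator[OF fd frame])
  note bounds = commuting_product_form_bounds[OF linV symV pos upper less_imp_le[OF K]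
      linS symS lowS uppS AB comm]

  have integrable: "integrable M (\<lambda>s. cinner f (F s) * cinner (V (F s)) f)" for f
    unfolding adjV by (rule continuous_frame_product_integrable[OF frame])
  have integral: "(\<integral>s. cinner f (F s) * cinner (V (F s)) f \<partial>M) = cinner (V (S f)) f" for f
    unfolding adjV by (simp add: S_def cinner_frame_operator[OF fd frame])
  have real: "cinner (V (S f)) f \<in> \<real>" for f
  proof -
    have "cinner (V (S f)) f = cinner f (V (S f))"
      by (simp add: adjV adjS comm)
    then have "cnj (cinner (V (S f)) f) = cinner (V (S f)) f"
      by (metis cinner_commute)
    then show ?thesis
      by (simp add: Reals_cnj_iff)
  qed
  define a where "a = A / (L\<^sup>2 * K)"
  \<comment> \<open>Taking the maximum keeps the bounds ordered even on the zero space.\<close>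
  define b where "b = max a ((2 * B - A) * K)"
  have low: "a * (norm f)\<^sup>2 \<le> Re (cinner (V (S f)) f)" for f
  proof -
    have "a * (norm f)\<^sup>2 \<le> a * (L\<^sup>2 * K * inner (V f) f)"
      using A K L by (intro mult_left_mono coercive) (simp add: a_def)
    also have "\<dots> = A * inner (V f) f"
      using K L by (simp add: a_def)
    also have "\<dots> \<le> inner (V (S f)) f"
      by (rule bounds)
    finally show ?thesis
      by (simp add: inner_eq_Re_cinner)
  qed
  have upp: "Re (cinner (V (S f)) f) \<le> b * (norm f)\<^sup>2" for f
  proof -
    have "inner (V (S f)) f \<le> (2 * B - A) * inner (V f) f"
      by (rule bounds)
    also have "\<dots> \<le> (2 * B - A) * (K * (norm f)\<^sup>2)"
      using A AB by (intro mult_left_mono upper) simp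
    also have "\<dots> \<le> b * (norm f)\<^sup>2"
      unfolding mult.assoc[symmetric] b_def by (intro mult_right_mono) simp_all
    finally show ?thesis
      by (simp add: inner_eq_Re_cinner)
  qed
  have ab: "0 < a" "a \<le> b"
    using A K L by (simp_all add: a_def b_def)
  have "weakly_measurable M F"
    using frame by (simp add: continuous_frame_def)
  then show ?thesis
    unfolding controlled_frame_def integral using GL integrable real low upp ab by blast
qed

end
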